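(* Let $r\ge3$. Suppose that $A$ is an associative $\Lambda$-torus and $A'$ is an associative $\Lambda'$-torus. Let $L(A)=\mathrm{sl}_{r+1}(A)$ and $L(A')=\mathrm{sl}_{r+1}(A')$. Then the following are equivalent: (a) $A$ is isograded-isomorphic to $A'$ or to $(A')^{\mathrm{op}}$. (b) $L(A)$ and $L(A')$ are bi-isomorphic. (c) $L(A)$ is isotopic to $L(A')$.
   Context: **Conventions.** $F$ is a field of characteristic $0$; all algebras are over $F$ and (except Lie algebras) unital. $\Lambda,\Lambda'$ are finitely generated free abelian groups. For a $\Lambda$-graded algebra $A=\bigoplus_\lambda A^\lambda$, $\mathrm{supp}_\Lambda(A)=\{\lambda:A^\lambda\ne0\}$. A $\Lambda$-graded algebra $A$ and a $\Lambda'$-graded algebra $A'$ are isograded-isomorphic if there are an algebra isomorphism $\eta:A\to A'$ and a group isomorphism $\eta_{\mathrm{gr}}:\Lambda\to\Lambda'$ with $\eta(A^\lambda)=A'^{\,\eta_{\mathrm{gr}}(\lambda)}$ for all $\lambda$. **Associative tori.** An associative $\Lambda$-torus is a $\Lambda$-graded associative algebra $A$ such that for $\lambda\in\mathrm{supp}_\Lambda(A)$ the space $A^\lambda$ is spanned by a single invertible element, and $\Lambda$ is generated by $\mathrm{supp}_\Lambda(A)$ (then $\mathrm{supp}_\Lambda(A)=\Lambda$). $A^{\mathrm{op}}$ is the graded space $A$ with product $x\cdot_{\mathrm{op}}y=yx$. **$\mathrm{sl}_{r+1}(A)$.** Let $\Delta=\{0\}\cup\{\varepsilon_i-\varepsilon_j:1\le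 i\ne j\le r+1\}$ be the root system of type $A_r$ ($\varepsilon_1,\dots,\varepsilon_{r+1}$ a basis of a space containing $\Delta$), $Q=\mathrm{span}_{\mathbb Z}\Delta$. $[A,A]$ is the span of commutators in $A$, and $L(A)=\mathrm{sl}_{r+1}(A)=\{X\in\mathrm{Mat}_{r+1}(A):\mathrm{tr}(X)\in[A,A]\}$ with commutator product. With $e_{ij}(x)=xe_{ij}$ ($e_{ij}$ matrix units), it is $Q\times\Lambda$-graded by $L(A)_{\varepsilon_i-\varepsilon_j}^\lambda=e_{ij}(A^\lambda)$ ($i\neq j$), $L(A)_0^\lambda=\{\sum_ie_{ii}(x_i):x_i\in A^\lambda,\ \sum_ix_i\in[A,A]\}$, and $0$ for $\alpha\in Q\setminus\Delta$. It is a centreless Lie $\Lambda$-torus of type $\Delta$. **Bi-isomorphism and isotopy of Lie tori of type $\Delta$.** For Lie tori $L=\bigoplus_{Q\times\Lambda}L_\beta^\lambda$, $L'=\bigoplus_{Q\times\Lambda'}L'^{\lambda}_\beta$ of type $\Delta$, a bi-isomorphism is a Lie algebra isomorphism $\varphi:L\to L'$ for which there are group isomorphisms $\varphi_r:Q\to Q$, $\varphi_e:\Lambda\to\Lambda'$ with $\varphi(L_\beta^\lambda)=L'^{\,\varphi_e(\lambda)}_{\varphi_r(\beta)}$. For a group homomorphism $s:Q\to\Lambda$, $L^{(s)}$ is the Lie algebra $L$ with grading $(L^{(s)})_\beta^\lambda=L_\beta^{\lambda+s(\beta)}$; $s$ is admissible for $L$ if $L_\beta^{s(\beta)}\ne0$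 for all $0\ne\beta\in\Delta$ (equivalently, $L^{(s)}$ is again a Lie torus; for $L=\mathrm{sl}_{r+1}(A)$ every $s$ is admissible), and then $L^{(s)}$ is an isotope of $L$. $L$ is isotopic to $L'$ if some isotope of $L$ is bi-isomorphic to $L'$. *)

theory Defs
  imports
    "HOL-Analysis.Determinants"
    "HOL-Computational_Algebra.Group_Closure"
begin

section \<open>Abelian groups\<close>

text \<open>
  An abelian group carries exactly one \<open>\<int>\<close>-module structure, so the existential quantifier
  over \<open>s\<close> does not introduce a choice.
\<close>

definition fg_free_abelian_group :: "'l::ab_group_add itself \<Rightarrow> bool" where
  "fg_free_abelian_group _ \<longleftrightarrow>
     (\<exists>(s :: int \<Rightarrow> 'l \<Rightarrow> 'l) B. module s \<and> finite B \<and>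
        \<not> module.dependent s B \<and> module.span s B = UNIV)"

definition group_hom_on :: "'q::ab_group_add set \<Rightarrow> ('q \<Rightarrow> 'l::ab_group_add) \<Rightarrow> bool" where
  "group_hom_on Q f \<longleftrightarrow> (\<forall>x\<in>Q. \<forall>y\<in>Q. f (x + y) = f x + f y)"

section \<open>Graded associative algebras and associative tori\<close>

text \<open>
  The algebra is the whole type \<open>'a\<close>, with its \<open>ring_1\<close> structure (so \<open>1 \<noteq> 0\<close>) and the scalar
  multiplication \<open>smul\<close>.
\<close>

locale assoc_algebra = vector_space smul
  for smul :: "'k::field_char_0 \<Rightarrow> 'a::ring_1 \<Rightarrow> 'a" +
  assumes mult_smul_left: "smul c x * y = smul c (x * y)"
    and mult_smul_right: "x * smul c y = smul c (x * y)"

definition graded_support :: "('l \<Rightarrow> 'a::zero set) \<Rightarrow> 'l set" where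
  "graded_support A = {l. A l \<noteq> {0}}"

locale graded_assoc_algebra = assoc_algebra smul
  for smul :: "'k::field_char_0 \<Rightarrow> 'a::ring_1 \<Rightarrow> 'a" +
  fixes A :: "'l::ab_group_add \<Rightarrow> 'a set"
  assumes subspace_component: "subspace (A l)"
    and direct_sum:
      "\<exists>!f. (\<forall>l. f l \<in> A l) \<and> finite {l. f l \<noteq> 0} \<and> x = (\<Sum>l | f l \<noteq> 0. f l)"
    and mult_component: "x \<in> A l \<Longrightarrow> y \<in> A m \<Longrightarrow> x * y \<in> A (l + m)"

locale assoc_torus = graded_assoc_algebra smul A
  for smul :: "'k::field_char_0 \<Rightarrow> 'a::ring_1 \<Rightarrow> 'a"
    and A :: "'l::ab_group_add \<Rightarrow> 'a set" +
  assumes one_dim_invertible: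
      "l \<in> graded_support A \<Longrightarrow> \<exists>x. (\<exists>y. x * y = 1 \<and> y * x = 1) \<and> A l = span {x}"
    and group_closure_support: "group_closure (graded_support A) = UNIV"

definition op_mult :: "'a::times \<Rightarrow> 'a \<Rightarrow> 'a" where
  "op_mult x y = y * x"

text \<open>
  The products are explicit arguments so that the opposite algebra needs no type of its own; it has
  the same unit, scalar multiplication and homogeneous components as the original algebra.
\<close>

definition isograded_isomorphic ::
  "('k::field_char_0 \<Rightarrow> 'a::ring_1 \<Rightarrow> 'a) \<Rightarrow> ('a \<Rightarrow> 'a \<Rightarrow> 'a) \<Rightarrow> ('l::ab_group_add \<Rightarrow> 'a set) \<Rightarrow>
   ('k \<Rightarrow> 'b::ring_1 \<Rightarrow> 'b) \<Rightarrow> ('b \<Rightarrow> 'b \<Rightarrow> 'b) \<Rightarrow> ('m::ab_group_add \<Rightarrow> 'b set) \<Rightarrow> bool" where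
  "isograded_isomorphic smul dot A smul' dot' A' \<longleftrightarrow>
     (\<exists>\<eta> \<eta>\<^sub>g\<^sub>r.
        Vector_Spaces.linear smul smul' \<eta> \<and> bij \<eta> \<and>
        (\<forall>x y. \<eta> (dot x y) = dot' (\<eta> x) (\<eta> y)) \<and> \<eta> 1 = 1 \<and>
        group_hom_on UNIV \<eta>\<^sub>g\<^sub>r \<and> bij \<eta>\<^sub>g\<^sub>r \<and>
        (\<forall>l. \<eta> ` A l = A' (\<eta>\<^sub>g\<^sub>r l)))"

section \<open>Graded Lie algebras, bi-isomorphism and isotopy\<close>

text \<open>
  A \<open>Q \<times> \<Lambda>\<close>-graded Lie algebra, realized on a subspace \<open>lie_carrier\<close> of the type \<open>'v\<close>. Here
  \<open>\<Lambda>\<close> is the type \<open>'l\<close>, whereas \<open>Q\<close> is the subgroup of \<open>'q\<close> generated by a root system \<open>\<Delta>\<close>, and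
  only the values of \<open>lie_comp\<close> on \<open>Q\<close> are ever used.
\<close>

record ('k, 'v, 'q, 'l) graded_lie =
  lie_carrier :: "'v set"
  lie_scale :: "'k \<Rightarrow> 'v \<Rightarrow> 'v"
  lie_bracket :: "'v \<Rightarrow> 'v \<Rightarrow> 'v"
  lie_comp :: "'q \<Rightarrow> 'l \<Rightarrow> 'v set"

definition lie_algebra_iso ::
  "('k, 'v::ab_group_add, 'q, 'l) graded_lie \<Rightarrow> ('k, 'w::ab_group_add, 'q, 'm) graded_lie \<Rightarrow>
   ('v \<Rightarrow> 'w) \<Rightarrow> bool" where
  "lie_algebra_iso L L' \<phi> \<longleftrightarrow>
     bij_betw \<phi> (lie_carrier L) (lie_carrier L') \<and>
     (\<forall>x\<in>lie_carrier L. \<forall>y\<in>lie_carrier L. \<phi> (x + y) = \<phi> x + \<phi> y) \<and>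
     (\<forall>c. \<forall>x\<in>lie_carrier L. \<phi> (lie_scale L c x) = lie_scale L' c (\<phi> x)) \<and>
     (\<forall>x\<in>lie_carrier L. \<forall>y\<in>lie_carrier L.
        \<phi> (lie_bracket L x y) = lie_bracket L' (\<phi> x) (\<phi> y))"

definition bi_isomorphic ::
  "'q::ab_group_add set \<Rightarrow> ('k, 'v::ab_group_add, 'q, 'l::ab_group_add) graded_lie \<Rightarrow>
   ('k, 'w::ab_group_add, 'q, 'm::ab_group_add) graded_lie \<Rightarrow> bool" where
  "bi_isomorphic \<Delta> L L' \<longleftrightarrow>
     (\<exists>\<phi> \<phi>\<^sub>r \<phi>\<^sub>e.
        lie_algebra_iso L L' \<phi> \<and>
        group_hom_on (group_closure \<Delta>) \<phi>\<^sub>r \<and>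
        bij_betw \<phi>\<^sub>r (group_closure \<Delta>) (group_closure \<Delta>) \<and>
        group_hom_on UNIV \<phi>\<^sub>e \<and> bij \<phi>\<^sub>e \<and>
        (\<forall>\<beta>\<in>group_closure \<Delta>. \<forall>l. \<phi> ` lie_comp L \<beta> l = lie_comp L' (\<phi>\<^sub>r \<beta>) (\<phi>\<^sub>e l)))"

definition regrade ::
  "('q \<Rightarrow> 'l) \<Rightarrow> ('k, 'v, 'q, 'l::ab_group_add) graded_lie \<Rightarrow> ('k, 'v, 'q, 'l) graded_lie" where
  "regrade s L = L\<lparr>lie_comp := \<lambda>\<beta> l. lie_comp L \<beta> (l + s \<beta>)\<rparr>"

definition admissible ::
  "'q::ab_group_add set \<Rightarrow> ('q \<Rightarrow> 'l) \<Rightarrow> ('k, 'v::ab_group_add, 'q, 'l) graded_lie \<Rightarrow> bool" where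
  "admissible \<Delta> s L \<longleftrightarrow> (\<forall>\<beta>\<in>\<Delta>. \<beta> \<noteq> 0 \<longrightarrow> lie_comp L \<beta> (s \<beta>) \<noteq> {0})"

definition isotopic ::
  "'q::ab_group_add set \<Rightarrow> ('k, 'v::ab_group_add, 'q, 'l::ab_group_add) graded_lie \<Rightarrow>
   ('k, 'w::ab_group_add, 'q, 'm::ab_group_add) graded_lie \<Rightarrow> bool" where
  "isotopic \<Delta> L L' \<longleftrightarrow>
     (\<exists>s. group_hom_on (group_closure \<Delta>) s \<and> admissible \<Delta> s L \<and>
          bi_isomorphic \<Delta> (regrade s L) L')"

section \<open>The root system of type A and the special linear Lie algebra\<close>

text \<open>
  Indices run over a finite type \<open>'n\<close>, so that \<open>A\<^sub>r\<close> is obtained for \<open>CARD('n) = r + 1\<close>;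
  \<open>\<epsilon>\<^sub>i = axis i 1\<close> is the standard basis of \<open>F\<^bsup>r+1\<^esup>\<close>.
\<close>

definition root_A :: "'n::finite \<Rightarrow> 'n \<Rightarrow> 'k::field_char_0 ^ 'n" where
  "root_A i j = axis i 1 - axis j 1"

definition roots_A :: "('k::field_char_0 ^ 'n::finite) set" where
  "roots_A = {0} \<union> {root_A i j | i j. i \<noteq> j}"

definition commutator_span :: "('k::field \<Rightarrow> 'a::ring_1 \<Rightarrow> 'a) \<Rightarrow> 'a set" where
  "commutator_span smul = module.span smul {x * y - y * x | x y. True}"

definition e_mat :: "'n::finite \<Rightarrow> 'n \<Rightarrow> 'a::zero \<Rightarrow> 'a ^ 'n ^ 'n" where
  "e_mat i j x = (\<chi> k l. if k = i \<and> l = j then x else 0)"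

definition sl_comp ::
  "('k::field_char_0 \<Rightarrow> 'a::ring_1 \<Rightarrow> 'a) \<Rightarrow> ('l \<Rightarrow> 'a set) \<Rightarrow>
   'k ^ 'n::finite \<Rightarrow> 'l \<Rightarrow> ('a ^ 'n ^ 'n) set" where
  "sl_comp smul A \<beta> l =
     (if \<beta> = 0 then
        {\<Sum>i\<in>UNIV. e_mat i i (x i) | x. (\<forall>i. x i \<in> A l) \<and> (\<Sum>i\<in>UNIV. x i) \<in> commutator_span smul}
      else if \<beta> \<in> roots_A then
        {e_mat i j x | i j x. i \<noteq> j \<and> \<beta> = root_A i j \<and> x \<in> A l}
      else {0})"

lemma root_A_eq_iff:
  assumes "i \<noteq> j" "k \<noteq> l"
  shows "(root_A i j :: 'k::field_char_0 ^ 'n::finite) = root_A k l \<longleftrightarrow> i = k \<and> j = l"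
proof
  assume eq: "(root_A i j :: 'k ^ 'n) = root_A k l"
  have "(root_A i j :: 'k ^ 'n) $ i = root_A k l $ i" "(root_A i j :: 'k ^ 'n) $ j = root_A k l $ j"
    by (simp_all add: eq)
  with assms show "i = k \<and> j = l"
    by (auto simp: root_A_def axis_def eq_neg_iff_add_eq_0 split: if_splits)
qed simp

lemma sl_comp_root:
  fixes smul :: "'k::field_char_0 \<Rightarrow> 'a::ring_1 \<Rightarrow> 'a" and i j :: "'n::finite"
  assumes "i \<noteq> j"
  shows "sl_comp smul A (root_A i j) l = e_mat i j ` A l"
proof -
  have "(root_A i j :: 'k ^ 'n) $ i \<noteq> 0"
    using assms by (simp add: root_A_def axis_def)
  hence "(root_A i j :: 'k ^ 'n) \<noteq> 0"
    by auto
  thus ?thesis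
    using assms by (auto simp: sl_comp_def roots_A_def root_A_eq_iff)
qed

definition sl ::
  "('k::field_char_0 \<Rightarrow> 'a::ring_1 \<Rightarrow> 'a) \<Rightarrow> ('l \<Rightarrow> 'a set) \<Rightarrow>
   ('k, 'a ^ 'n::finite ^ 'n, 'k ^ 'n, 'l) graded_lie" where
  "sl smul A =
     \<lparr>lie_carrier = {X. trace X \<in> commutator_span smul},
      lie_scale = (\<lambda>c X. \<chi> i j. smul c (X $ i $ j)),
      lie_bracket = (\<lambda>X Y. X ** Y - Y ** X),
      lie_comp = sl_comp smul A\<rparr>"

end

theory Submission
  imports Defs
begin

text \<open>
  The interesting implication is from isotopy to isomorphism of tori. Only three distinct indices
  \<open>i, j, k\<close> are needed. The roots \<open>\<epsilon>\<^sub>i - \<epsilon>\<^sub>j\<close> and \<open>\<epsilon>\<^sub>j - \<epsilon>\<^sub>k\<close> and their sum are carried to roots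
  \<open>\<epsilon>\<^sub>a - \<epsilon>\<^sub>b\<close> and \<open>\<epsilon>\<^sub>c - \<epsilon>\<^sub>d\<close> whose sum is again a root, so that \<open>b = c\<close> or \<open>a = d\<close>. Comparing brackets,
  the bijections \<open>h, k, g\<close> induced between the three root spaces satisfy \<open>g (x y) = h x * k y\<close> in the
  first case and \<open>g (x y) = - k y * h x\<close> in the second. Hence \<open>x \<mapsto> g x * (g 1)\<inverse>\<close> is an isomorphism
  or an anti-isomorphism, and the degree shift of the isotope cancels because \<open>g 1\<close> is homogeneous.
\<close>

section \<open>Graded algebras and tori\<close>

context graded_assoc_algebra
begin

lemma zero_component: "0 \<in> A l"
  using subspace_component subspace_0 by blast

lemma uminus_component_iff: "- x \<in> A l \<longleftrightarrow> x \<in> A l"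
  using subspace_component subspace_neg by fastforce

lemma component_induct [case_names zero add component]:
  assumes "P 0" and "\<And>x y. P x \<Longrightarrow> P y \<Longrightarrow> P (x + y)" and "\<And>l x. x \<in> A l \<Longrightarrow> P x"
  shows "P x"
proof -
  obtain f where f: "\<forall>l. f l \<in> A l" "finite {l. f l \<noteq> 0}" "x = (\<Sum>l | f l \<noteq> 0. f l)"
    using direct_sum by blast
  have "P (\<Sum>l\<in>S. f l)" if "finite S" for S
    using that by induction (simp_all add: assms(1) assms(2) assms(3)[OF f(1)[rule_format]])
  thus ?thesis
    using f by auto
qed

text \<open>The uniqueness half of \<open>direct_sum\<close>, loosened to arbitrary finite index
  sets so that shifted decompositions can be compared without computing their exact
  supports.\<close>

lemma finite_component_sum_unique:
  assumes "finite S" "finite T" "\<And>l. f l \<in> A l" "\<And>l. g l \<in> A l"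
    and "\<And>l. l \<notin> S \<Longrightarrow> f l = 0" "\<And>l. l \<notin> T \<Longrightarrow> g l = 0"
    and "(\<Sum>l\<in>S. f l) = (\<Sum>l\<in>T. g l)"
  shows "f = g"
proof -
  have *: "finite {l. f l \<noteq> 0}" "finite {l. g l \<noteq> 0}"
    using assms(1,2,5,6) by (auto intro: finite_subset[of _ S] finite_subset[of _ T])
  have "(\<Sum>l\<in>S. f l) = (\<Sum>l | f l \<noteq> 0. f l)" "(\<Sum>l\<in>T. g l) = (\<Sum>l | g l \<noteq> 0. g l)"
    using assms(1,2,5,6) by (auto intro!: sum.mono_neutral_right)
  with * assms direct_sum[of "\<Sum>l\<in>S. f l"] show ?thesis
    by metis
qed

text \<open>The degree 0 part \<open>f 0\<close> of the unit acts as a right identity on homogeneous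
  elements, hence by additivity on everything; applied to 1 itself this gives
  \<open>f 0 = 1\<close>.\<close>

lemma one_component: "1 \<in> A 0"
proof -
  obtain f where f: "\<forall>l. f l \<in> A l" "finite {l. f l \<noteq> 0}" "1 = (\<Sum>l | f l \<noteq> 0. f l)"
    using direct_sum by blast
  let ?S = "{l. f l \<noteq> 0}"
  have fix0: "x * f 0 = x" if x: "x \<in> A m" for x m
  proof -
    \<comment> \<open>Two decompositions of \<open>x * 1 = x\<close>: \<open>?g\<close> shifts that
      of 1 by the degree of \<open>x\<close>, \<open>?h\<close> is the trivial one. They are
      compared in degree \<open>m\<close>.\<close>
    let ?g = "\<lambda>l. x * f (l - m)" and ?h = "\<lambda>l. if l = m then x else 0"
    have "(\<Sum>l\<in>(\<lambda>l. l + m) ` ?S. ?g l) = (\<Sum>l\<in>?S. x * f l)"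
      by (subst sum.reindex) (auto simp: inj_on_def)
    also have "\<dots> = x * 1"
      by (subst f(3)) (simp add: sum_distrib_left)
    finally have eq: "(\<Sum>l\<in>(\<lambda>l. l + m) ` ?S. ?g l) = (\<Sum>l\<in>{m}. ?h l)"
      by simp
    have "?g = ?h"
    proof (rule finite_component_sum_unique[OF _ _ _ _ _ _ eq])
      show "?g l \<in> A l" for l
        using mult_component[OF x, of "f (l - m)" "l - m"] f by simp
      show "?g l = 0" if "l \<notin> (\<lambda>l. l + m) ` ?S" for l
      proof -
        have "f (l - m) = 0"
          using that by (metis (mono_tags, lifting) diff_add_cancel image_eqI mem_Collect_eq)
        thus ?thesis by simp
      qed
    qed (use f x zero_component in auto)
    from fun_cong[OF this, of m] show ?thesis by simp
  qed
  have "x * f 0 = x" for x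
    by (induction x rule: component_induct) (auto simp: distrib_right fix0)
  from this[of 1] f show ?thesis by (metis mult_1)
qed

text \<open>Since \<open>x * y = 1\<close> lives in degree 0, the part of \<open>y\<close> of degree
  \<open>- l\<close> is already a right inverse of \<open>x\<close>, and a right inverse must equal
  the left inverse \<open>y\<close>.\<close>

lemma inverse_component:
  assumes x: "x \<in> A l" and inv: "x * y = 1" "y * x = 1"
  shows "y \<in> A (- l)"
proof -
  obtain f where f: "\<forall>l. f l \<in> A l" "finite {l. f l \<noteq> 0}" "y = (\<Sum>l | f l \<noteq> 0. f l)"
    using direct_sum by blast
  let ?S = "{l. f l \<noteq> 0}"
  let ?g = "\<lambda>m. x * f (m - l)" and ?h = "\<lambda>m. if m = 0 then 1 else 0"
  have "(\<Sum>m\<in>(\<lambda>m. m + l) ` ?S. ?g m) = (\<Sum>m\<in>?S. x * f m)"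
    by (subst sum.reindex) (auto simp: inj_on_def)
  also have "\<dots> = x * y"
    by (subst f(3)) (simp add: sum_distrib_left)
  finally have eq: "(\<Sum>m\<in>(\<lambda>m. m + l) ` ?S. ?g m) = (\<Sum>m\<in>{0}. ?h m)"
    by (simp add: inv)
  have "?g = ?h"
  proof (rule finite_component_sum_unique[OF _ _ _ _ _ _ eq])
    show "?g m \<in> A m" for m
      using mult_component[OF x, of "f (m - l)" "m - l"] f by simp
    show "?g m = 0" if "m \<notin> (\<lambda>m. m + l) ` ?S" for m
    proof -
      have "f (m - l) = 0"
        using that by (metis (mono_tags, lifting) diff_add_cancel image_eqI mem_Collect_eq)
      thus ?thesis by simp
    qed
  qed (use f one_component zero_component in auto)
  from fun_cong[OF this, of 0] have "x * f (- l) = 1" by simp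
  hence "f (- l) = y"
    by (metis inv(2) mult.assoc mult_1 mult_1_right)
  thus ?thesis using f by metis
qed

end

section \<open>Invertible homogeneous elements and the support of a torus\<close>

context assoc_torus
begin

lemma component_invertible:
  assumes "x \<in> A l" "x \<noteq> 0"
  shows "\<exists>y. x * y = 1 \<and> y * x = 1"
proof -
  have "l \<in> graded_support A"
    using assms by (auto simp: graded_support_def)
  from one_dim_invertible[OF this] obtain z w where
    z: "z * w = 1" "w * z = 1" and Al: "A l = span {z}" by blast
  then obtain c where c: "x = smul c z"
    using assms by (auto simp: span_singleton)
  with assms have "c \<noteq> 0" by auto
  hence "x * smul (inverse c) w = 1" "smul (inverse c) w * x = 1"
    by (simp_all add: c mult_smul_left mult_smul_right z)
  thus ?thesis by blast
qed

text \<open>The support is a subgroup: it contains 0 because of the unit, and it is closed under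
  differences because \<open>x * y'\<close>, with \<open>y'\<close> the inverse of \<open>y\<close>,
  is again invertible and so nonzero.\<close>

lemma graded_support_torus: "graded_support A = UNIV"
proof -
  have "l \<in> graded_support A" if "l \<in> group_closure (graded_support A)" for l
    using that
  proof induction
    case (base s)
    have "0 \<in> graded_support A"
      using one_component by (auto simp: graded_support_def)
    with base show ?case by auto
  next
    case (diff s t)
    then obtain x y where "x \<in> A s" "x \<noteq> 0" "y \<in> A t" "y \<noteq> 0"
      using zero_component by (fastforce simp: graded_support_def)
    then obtain x' y' where inv: "x * x' = 1" "x' * x = 1" "y * y' = 1" "y' * y = 1"
      using component_invertible by metis
    have "x * y' \<in> A (s + - t)"
      using \<open>x \<in> A s\<close> \<open>y \<in> A t\<close> inv by (blast intro: mult_component inverse_component)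
    moreover have "x * y' \<noteq> 0"
      by (metis inv(2,4) mult.assoc mult_1 mult_zero_left mult_zero_right one_neq_zero)
    ultimately show ?case
      by (auto simp: graded_support_def)
  qed
  thus ?thesis
    using group_closure_support by blast
qed

lemma component_nonzero: "A l \<noteq> {0}"
  using graded_support_torus by (auto simp: graded_support_def)

end


section \<open>Matrix units and the components of the special linear Lie algebra\<close>

lemma e_mat_nth: "e_mat i j x $ p $ q = (if p = i \<and> q = j then x else 0)"
  by (simp add: e_mat_def)

lemma e_mat_eq_iff [simp]: "e_mat i j x = e_mat i j y \<longleftrightarrow> x = y"
  by (auto simp: vec_eq_iff e_mat_nth)

lemma e_mat_zero [simp]: "e_mat i j 0 = 0"
  by (simp add: vec_eq_iff e_mat_nth)

lemma e_mat_add: "e_mat i j (x + y) = e_mat i j x + e_mat i j (y :: 'a::monoid_add)"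
  by (simp add: vec_eq_iff e_mat_nth)

lemma e_mat_uminus: "e_mat i j (- x) = - e_mat i j (x :: 'a::group_add)"
  by (simp add: vec_eq_iff e_mat_nth)

lemma e_mat_mult:
  "e_mat i j x ** e_mat k l (y :: 'a::semiring_1) = (if j = k then e_mat i l (x * y) else 0)"
  by (auto simp: vec_eq_iff matrix_matrix_mult_def e_mat_nth if_distrib[of "\<lambda>x. x * _"]
        if_distrib[of "\<lambda>x. _ * x"] sum.delta cong: if_cong intro!: sum.neutral)

lemma trace_e_mat: "i \<noteq> j \<Longrightarrow> trace (e_mat i j x) = 0"
  by (auto simp: trace_def e_mat_nth intro!: sum.neutral)

lemma diagonal_e_mat_nth: "(\<Sum>i\<in>UNIV. e_mat i i (x i)) $ p $ q = (if p = q then x p else 0)"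
  by (auto simp: e_mat_nth sum_component intro!: sum.neutral)

lemma root_A_nonzero: "i \<noteq> j \<Longrightarrow> root_A i j \<noteq> (0 :: 'k::field_char_0 ^ 'n::finite)"
  by (auto simp: root_A_def vec_eq_iff axis_def dest: spec[of _ i])

lemma uminus_root_A: "- root_A i j = root_A j i"
  by (simp add: root_A_def)

lemma root_A_in_group_closure: "i \<noteq> j \<Longrightarrow> root_A i j \<in> group_closure roots_A"
  by (rule group_closure.base) (auto simp: roots_A_def)

text \<open>Only two of the four basis vectors may survive, so a positive term of one root cancels
  the negative term of the other. Comparing the coordinates at the six indices decides all cases in
  characteristic 0.\<close>

lemma root_A_add_eq_root_A:
  assumes "a \<noteq> b" "c \<noteq> d" "e \<noteq> f"
    and "root_A a b + root_A c d = (root_A e f :: 'k::field_char_0 ^ 'n::finite)"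
  shows "b = c \<and> e = a \<and> f = d \<or> a = d \<and> e = c \<and> f = b"
proof -
  have *: "(if a = x then 1 else 0) - (if b = x then 1 else 0) + (if c = x then 1 else 0)
       - (if d = x then 1 else 0) = (if e = x then 1 else 0) - (if f = x then 1 else (0::'k))" for x
    using arg_cong[OF assms(4), of "\<lambda>v. v $ x"] by (simp add: root_A_def axis_def eq_commute)
  show ?thesis
    using assms(1-3) *[of a] *[of b] *[of c] *[of d] *[of e] *[of f]
    by (auto split: if_splits)
qed

text \<open>An entrywise membership test, from which images under entrywise or transposing maps can
  be read off.\<close>

lemma sl_comp_zero_iff:
  "X \<in> sl_comp smul A 0 l \<longleftrightarrow>
     (\<forall>i j. i \<noteq> j \<longrightarrow> X $ i $ j = 0) \<and> (\<forall>i. X $ i $ i \<in> A l) \<and> trace X \<in> commutator_span smul"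
  (is "_ \<longleftrightarrow> ?R")
proof
  assume ?R
  moreover from this have "X = (\<Sum>i\<in>UNIV. e_mat i i (X $ i $ i))"
    by (auto simp: vec_eq_iff diagonal_e_mat_nth simp del: sum_component)
  ultimately show "X \<in> sl_comp smul A 0 l"
    by (auto simp: sl_comp_def trace_def)
qed (auto simp: sl_comp_def trace_def diagonal_e_mat_nth simp del: sum_component)

lemma sl_comp_root_iff:
  assumes "i \<noteq> j"
  shows "X \<in> sl_comp smul A (root_A i j) l \<longleftrightarrow>
    X $ i $ j \<in> A l \<and> (\<forall>p q. (p, q) \<noteq> (i, j) \<longrightarrow> X $ p $ q = 0)"
    (is "_ \<longleftrightarrow> ?R")
proof
  assume ?R
  moreover from this have "X = e_mat i j (X $ i $ j)"
    by (auto simp: vec_eq_iff e_mat_nth)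
  ultimately show "X \<in> sl_comp smul A (root_A i j) l"
    unfolding sl_comp_root[OF assms] by blast
qed (auto simp: sl_comp_root[OF assms] e_mat_nth)

lemma sl_comp_nonroot: "\<beta> \<notin> roots_A \<Longrightarrow> sl_comp smul A \<beta> l = {0}"
  by (auto simp: sl_comp_def roots_A_def)

section \<open>From isomorphic tori to bi-isomorphic Lie algebras\<close>

text \<open>\<eta> maps the set of commutators onto that of the target; an anti-isomorphism merely
  swaps the two arguments of a commutator. Linear images commute with spans, and injectivity yields
  the equivalence.\<close>

lemma (in assoc_algebra) commutator_span_iff:
  assumes lin: "Vector_Spaces.linear smul smul' \<eta>" and bij: "bij \<eta>"
    and mult: "(\<forall>x y. \<eta> (x * y) = \<eta> x * \<eta> y) \<or> (\<forall>x y. \<eta> (x * y) = \<eta> y * \<eta> x)"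
  shows "\<eta> x \<in> commutator_span smul' \<longleftrightarrow> x \<in> commutator_span smul"
proof -
  interpret lin: Vector_Spaces.linear smul smul' \<eta> by (fact lin)
  have "\<eta> ` {x * y - y * x | x y. True} = {x * y - y * x | x y. True}" (is "_ ` ?S = ?T")
  proof (intro equalityI subsetI)
    fix z assume "z \<in> \<eta> ` ?S"
    thus "z \<in> ?T" using mult by (auto simp: lin.diff) blast+
  next
    fix z assume "z \<in> ?T"
    then obtain x y where "z = \<eta> x * \<eta> y - \<eta> y * \<eta> x"
      using bij by (auto simp: bij_def) (metis surjD)
    hence "z = \<eta> (x * y - y * x) \<or> z = \<eta> (y * x - x * y)"
      using mult by (auto simp: lin.diff)
    thus "z \<in> \<eta> ` ?S" by blast
  qed
  hence "commutator_span smul' = \<eta> ` commutator_span smul"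
    unfolding commutator_span_def using lin.span_image[of ?S] by simp
  thus ?thesis
    using bij by (auto simp: bij_def inj_def)
qed

lemma image_eq_of_bij:
  assumes "bij f" "\<And>x. f x \<in> T \<longleftrightarrow> x \<in> S"
  shows "f ` S = T"
proof -
  have "T = f ` f -` T"
    using assms(1) by (simp add: bij_def)
  also have "f -` T = S"
    using assms(2) by auto
  finally show ?thesis by simp
qed

text \<open>
  The flag \<open>t\<close> selects between the entrywise map and the negated transpose, which turns an
  anti-isomorphism of coordinate algebras into an isomorphism of Lie algebras.
\<close>

lemma bi_isomorphic_sl:
  fixes smul :: "'k::field_char_0 \<Rightarrow> 'a::ring_1 \<Rightarrow> 'a"
    and A :: "'l::ab_group_add \<Rightarrow> 'a set"
    and smul' :: "'k \<Rightarrow> 'b::ring_1 \<Rightarrow> 'b"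
    and A' :: "'m::ab_group_add \<Rightarrow> 'b set"
  assumes A: "graded_assoc_algebra smul A" and A': "graded_assoc_algebra smul' A'"
    and lin: "Vector_Spaces.linear smul smul' \<eta>" and bij: "bij \<eta>"
    and mult: "\<And>x y. \<eta> (x * y) = (if t then \<eta> y * \<eta> x else \<eta> x * \<eta> y)"
    and hom: "group_hom_on UNIV \<gamma>" and bij_\<gamma>: "bij \<gamma>"
    and comp: "\<And>l. \<eta> ` A l = A' (\<gamma> l)"
  shows "bi_isomorphic roots_A (sl smul A :: ('k, 'a ^ 'n::finite ^ 'n, _, _) graded_lie) (sl smul' A')"
proof -
  interpret A: graded_assoc_algebra smul A by (fact A)
  interpret A': graded_assoc_algebra smul' A' by (fact A')
  interpret lin: Vector_Spaces.linear smul smul' \<eta> by (fact lin)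
  define \<phi> :: "'a ^ 'n ^ 'n \<Rightarrow> 'b ^ 'n ^ 'n"
    where "\<phi> X = (\<chi> p q. if t then - \<eta> (X $ q $ p) else \<eta> (X $ p $ q))" for X
  \<comment> \<open>Transposition exchanges the positions \<open>(i, j)\<close> and
    \<open>(j, i)\<close>, which negates the root.\<close>
  define \<phi>r :: "'k ^ 'n \<Rightarrow> 'k ^ 'n" where "\<phi>r = (if t then uminus else id)"
  have \<phi>_nth: "\<phi> X $ p $ q = (if t then - \<eta> (X $ q $ p) else \<eta> (X $ p $ q))" for X p q
    by (simp add: \<phi>_def)
  have \<eta>_eq: "\<eta> x = \<eta> y \<longleftrightarrow> x = y" for x y
    using bij by (auto simp: bij_def inj_def)
  have \<eta>_0: "\<eta> x = 0 \<longleftrightarrow> x = 0" for x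
    using \<eta>_eq[of x 0] by simp
  have \<eta>_comp: "\<eta> x \<in> A' (\<gamma> l) \<longleftrightarrow> x \<in> A l" for x l
    unfolding comp[symmetric] by (auto simp: \<eta>_eq)
  have comm: "\<eta> x \<in> commutator_span smul' \<longleftrightarrow> x \<in> commutator_span smul" for x
    using A.commutator_span_iff[OF lin bij] mult by (cases t) auto
  have neg_comm: "- x \<in> commutator_span smul' \<longleftrightarrow> x \<in> commutator_span smul'" for x
    unfolding commutator_span_def using A'.span_neg[of x] A'.span_neg[of "- x"] by auto
  have bij_\<phi>: "bij \<phi>"
  proof (rule bijI)
    show "inj \<phi>"
      by (rule injI) (auto simp: vec_eq_iff \<phi>_nth \<eta>_eq split: if_splits)
    show "surj \<phi>"
    proof (rule surjI)
      fix Y :: "'b ^ 'n ^ 'n"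
      show "\<phi> (\<chi> p q. if t then inv \<eta> (- Y $ q $ p) else inv \<eta> (Y $ p $ q)) = Y"
        using bij by (simp add: vec_eq_iff \<phi>_nth bij_def surj_f_inv_f)
    qed
  qed
  have trace_\<phi>: "trace (\<phi> X) = (if t then - \<eta> (trace X) else \<eta> (trace X))" for X
    by (simp add: trace_def \<phi>_nth lin.sum sum_negf)
  have trace_iff: "trace (\<phi> X) \<in> commutator_span smul' \<longleftrightarrow> trace X \<in> commutator_span smul" for X
    by (simp add: trace_\<phi> comm neg_comm)
  \<comment> \<open>In the transposed case
    \<open>\<phi> (X ** Y) = - (\<phi> Y ** \<phi> X)\<close>, and the sign restores the order of
    the commutator.\<close>
  have bracket: "\<phi> (X ** Y - Y ** X) = \<phi> X ** \<phi> Y - \<phi> Y ** \<phi> X" for X Y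
    by (simp add: vec_eq_iff \<phi>_nth matrix_matrix_mult_def lin.diff lin.sum mult)
  have "lie_algebra_iso (sl smul A) (sl smul' A') \<phi>"
    unfolding lie_algebra_iso_def
  proof (intro conjI ballI allI)
    \<comment> \<open>\<phi> is bijective on all matrices; the trace criterion restricts it to the
      Lie algebras.\<close>
    show "bij_betw \<phi> (lie_carrier (sl smul A)) (lie_carrier (sl smul' A'))"
    proof (rule bij_betw_imageI)
      show "\<phi> ` lie_carrier (sl smul A) = lie_carrier (sl smul' A')"
        by (rule image_eq_of_bij[OF bij_\<phi>]) (simp add: sl_def trace_iff)
    qed (use bij_\<phi> in \<open>auto simp: bij_def inj_on_def\<close>)
  qed (simp_all add: sl_def vec_eq_iff \<phi>_nth lin.add lin.scale bracket[unfolded vec_eq_iff \<phi>_nth]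
        A'.scale_minus_right)
  moreover have "group_hom_on (group_closure roots_A) \<phi>r"
    by (simp add: group_hom_on_def \<phi>r_def)
  moreover have "bij_betw \<phi>r (group_closure roots_A) (group_closure roots_A)"
    by (rule bij_betwI[where g = \<phi>r]) (auto simp: \<phi>r_def)
  moreover have "\<phi> ` sl_comp smul A \<beta> l = sl_comp smul' A' (\<phi>r \<beta>) (\<gamma> l)" for \<beta> l
  proof -
    consider "\<beta> = 0" | i j where "i \<noteq> j" "\<beta> = root_A i j" | "\<beta> \<notin> roots_A"
      by (auto simp: roots_A_def)
    thus ?thesis
    proof cases
      case 1
      show ?thesis
        by (rule image_eq_of_bij[OF bij_\<phi>])
           (auto simp: 1 \<phi>r_def sl_comp_zero_iff trace_iff \<phi>_nth \<eta>_0 \<eta>_comp A'.uminus_component_iff)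
    next
      case 2
      hence "\<phi>r \<beta> = (if t then root_A j i else root_A i j)"
        by (simp add: \<phi>r_def uminus_root_A)
      thus ?thesis using 2
        by (intro image_eq_of_bij[OF bij_\<phi>])
           (auto simp: sl_comp_root_iff \<phi>_nth \<eta>_0 \<eta>_comp A'.uminus_component_iff)
    next
      case 3
      hence "\<phi>r \<beta> \<notin> roots_A"
        by (auto simp: \<phi>r_def roots_A_def) (metis minus_minus uminus_root_A)
      moreover have "\<phi> 0 = 0"
        by (simp add: vec_eq_iff \<phi>_nth)
      ultimately show ?thesis
        using 3 by (simp add: sl_comp_nonroot)
    qed
  qed
  ultimately show ?thesis
    unfolding bi_isomorphic_def using hom bij_\<gamma>
    by (intro exI[of _ \<phi>] exI[of _ \<phi>r] exI[of _ \<gamma>]) (auto simp: sl_def)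
qed

text \<open>The zero shift leaves the grading unchanged; it is admissible because the degree 0
  component of a torus is nonzero.\<close>

lemma (in assoc_torus) isotopic_of_bi_isomorphic:
  fixes L' :: "('k, 'w::ab_group_add, 'k ^ 'n::finite, 'm::ab_group_add) graded_lie"
  assumes "bi_isomorphic roots_A (sl smul A) L'"
  shows "isotopic roots_A (sl smul A) L'"
  unfolding isotopic_def
proof (intro exI conjI)
  show "group_hom_on (group_closure roots_A) (\<lambda>_ :: 'k ^ 'n. 0 :: 'l)"
    by (simp add: group_hom_on_def)
  show "admissible roots_A (\<lambda>_. 0) (sl smul A :: ('k, 'a ^ 'n ^ 'n, 'k ^ 'n, 'l) graded_lie)"
    unfolding admissible_def
  proof (intro ballI impI)
    fix \<beta> :: "'k ^ 'n" assume "\<beta> \<in> roots_A" "\<beta> \<noteq> 0"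
    then obtain i j where "i \<noteq> j" "\<beta> = root_A i j"
      by (auto simp: roots_A_def)
    moreover obtain x where "x \<in> A 0" "x \<noteq> 0"
      using component_nonzero[of 0] zero_component[of 0] by blast
    ultimately show "lie_comp (sl smul A) \<beta> 0 \<noteq> {0}"
      by (auto simp: sl_def sl_comp_root) (metis e_mat_eq_iff e_mat_zero imageI singletonD)
  qed
  show "bi_isomorphic roots_A (regrade (\<lambda>_. 0) (sl smul A)) L'"
    using assms by (simp add: regrade_def)
qed


section \<open>From isotopic Lie algebras to isomorphic tori\<close>

text \<open>As \<open>g\<close> shifts degrees by \<tau>, the element \<open>g 1\<close> has degree
  \<tau> and its inverse \<open>v\<close> has degree -\<tau>. Right multiplication by
  \<open>v\<close> therefore both cancels the shift and normalises the image of 1. Leaving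
  \<open>dot'\<close> open covers the product and its opposite at once.\<close>

lemma isograded_isomorphic_twist:
  assumes A: "assoc_torus smul A" and A': "assoc_torus smul' A'"
    and lin: "Vector_Spaces.linear smul smul' g" and bij: "bij g"
    and comp: "\<And>l. g ` A l = A' (\<gamma> l + \<tau>)"
    and hom: "group_hom_on UNIV \<gamma>" and bij_\<gamma>: "bij \<gamma>"
    and inv: "g 1 * v = 1" "v * g 1 = 1"
    and dot: "\<And>x y. g (x * y) * v = dot' (g x * v) (g y * v)"
  shows "isograded_isomorphic smul (*) A smul' dot' A'"
proof -
  interpret A: assoc_torus smul A by (fact A)
  interpret A': assoc_torus smul' A' by (fact A')
  interpret lin: Vector_Spaces.linear smul smul' g by (fact lin)
  define \<eta> where "\<eta> x = g x * v" for x
  have "\<gamma> 0 = 0"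
    using hom by (auto simp: group_hom_on_def dest: spec[of _ 0])
  hence u: "g 1 \<in> A' \<tau>"
    using comp[of 0] A.one_component by auto
  hence v: "v \<in> A' (- \<tau>)"
    using inv by (rule A'.inverse_component)
  have cancel: "y * g 1 * v = y" "y * v * g 1 = y" for y
    using inv by (simp_all add: mult.assoc)
  have "Vector_Spaces.linear smul smul' \<eta>"
    by unfold_locales (simp_all add: \<eta>_def lin.add lin.scale distrib_right A'.mult_smul_left)
  moreover have "bij \<eta>"
  proof (rule bijI)
    show "inj \<eta>"
      using bij unfolding \<eta>_def bij_def inj_def by (metis cancel(2))
    show "surj \<eta>"
      by (rule surjI[of _ "\<lambda>y. inv_into UNIV g (y * g 1)"])
         (use bij in \<open>simp add: \<eta>_def bij_def surj_f_inv_f cancel\<close>)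
  qed
  moreover have "\<eta> ` A l = A' (\<gamma> l)" for l
  proof (intro equalityI subsetI)
    fix y assume "y \<in> \<eta> ` A l"
    then obtain x where "x \<in> A l" "y = g x * v" by (auto simp: \<eta>_def)
    hence "y \<in> A' ((\<gamma> l + \<tau>) + - \<tau>)"
      using comp v by (blast intro: A'.mult_component)
    thus "y \<in> A' (\<gamma> l)" by simp
  next
    fix y assume "y \<in> A' (\<gamma> l)"
    hence "y * g 1 \<in> A' (\<gamma> l + \<tau>)"
      using u by (rule A'.mult_component)
    then obtain x where "x \<in> A l" "g x = y * g 1"
      unfolding comp[symmetric] by auto
    hence "\<eta> x = y" by (simp add: \<eta>_def cancel)
    thus "y \<in> \<eta> ` A l" using \<open>x \<in> A l\<close> by blast
  qed
  ultimately show ?thesis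
    unfolding isograded_isomorphic_def using hom bij_\<gamma> dot inv
    by (intro exI[of _ \<eta>] exI[of _ \<gamma>]) (simp add: \<eta>_def)
qed

text \<open>
  A factorisation \<open>g (x y) = h x * k y\<close> forces \<open>h x = g x * (k 1)\<inverse>\<close> and \<open>k y = (h 1)\<inverse> * g y\<close>, so that
  \<open>g\<close> is multiplicative up to the invertible element \<open>g 1 = h 1 * k 1\<close>.
\<close>

lemma isograded_isomorphic_of_factorisation:
  assumes A: "assoc_torus smul A" and A': "assoc_torus smul' A'"
    and lin: "Vector_Spaces.linear smul smul' g" and bij: "bij g"
    and comp: "\<And>l. g ` A l = A' (\<gamma> l + \<tau>)"
    and hom: "group_hom_on UNIV \<gamma>" and bij_\<gamma>: "bij \<gamma>"
  shows "(\<And>x y. g (x * y) = h x * k y) \<Longrightarrow> w * h 1 = 1 \<Longrightarrow>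
           isograded_isomorphic smul (*) A smul' (*) A'"
    and "(\<And>x y. g (x * y) = k y * h x) \<Longrightarrow> w * k 1 = 1 \<Longrightarrow>
           isograded_isomorphic smul (*) A smul' op_mult A'"
proof -
  interpret A: assoc_torus smul A by (fact A)
  interpret A': assoc_torus smul' A' by (fact A')
  interpret lin: Vector_Spaces.linear smul smul' g by (fact lin)
  have "g 1 \<noteq> 0"
    using bij lin.zero by (metis bij_pointE one_neq_zero)
  moreover have "g 1 \<in> A' (\<gamma> 0 + \<tau>)"
    using comp[of 0] A.one_component by blast
  ultimately obtain v where v: "g 1 * v = 1" "v * g 1 = 1"
    using A'.component_invertible by blast
  \<comment> \<open>As \<open>v\<close> inverts \<open>a * b\<close>, the product
    \<open>w * (a * b * v) * a\<close> is \<open>w * a = 1\<close>; cancelling \<open>w * a\<close>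
    in front of it leaves \<open>b * v * a\<close>.\<close>
  have middle: "b * v * a = 1" if "g 1 = a * b" "w * a = 1" for a b
  proof -
    have "w * (a * b * v) * a = w * a"
      using v that by simp
    thus ?thesis using that by (simp add: mult.assoc flip: mult.assoc[of w a])
  qed
  show "isograded_isomorphic smul (*) A smul' (*) A'"
    if fac: "\<And>x y. g (x * y) = h x * k y" and w: "w * h 1 = 1"
  proof (rule isograded_isomorphic_twist[OF A A' lin bij comp hom bij_\<gamma> v])
    fix x y
    \<comment> \<open>Here \<open>g x = h x * k 1\<close> and \<open>g y = h 1 * k y\<close>; the
      bracketed factor collapses to 1 by \<open>middle\<close>.\<close>
    have "g x * v * g y = h x * (k 1 * v * h 1) * k y"
      using fac[of x 1] fac[of 1 y] by (simp add: mult.assoc)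
    also have "\<dots> = g (x * y)"
      using middle[of "h 1" "k 1"] fac[of 1 1] w fac by simp
    finally show "g (x * y) * v = g x * v * (g y * v)"
      by (simp flip: mult.assoc)
  qed
  show "isograded_isomorphic smul (*) A smul' op_mult A'"
    if fac: "\<And>x y. g (x * y) = k y * h x" and w: "w * k 1 = 1"
  proof (rule isograded_isomorphic_twist[OF A A' lin bij comp hom bij_\<gamma> v])
    fix x y
    have "g y * v * g x = k y * (h 1 * v * k 1) * h x"
      using fac[of x 1] fac[of 1 y] by (simp add: mult.assoc)
    also have "\<dots> = g (x * y)"
      using middle[of "k 1" "h 1"] fac[of 1 1] w fac by simp
    finally show "g (x * y) * v = op_mult (g x * v) (g y * v)"
      by (simp add: op_mult_def flip: mult.assoc)
  qed
qed

text \<open>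
  The components of the domain carry an arbitrary degree shift \<open>t\<close>, which is what an isotope does to
  a single root space.
\<close>

lemma root_space_map:
  fixes smul :: "'k::field_char_0 \<Rightarrow> 'a::ring_1 \<Rightarrow> 'a"
    and A :: "'l::ab_group_add \<Rightarrow> 'a set"
    and smul' :: "'k \<Rightarrow> 'b::ring_1 \<Rightarrow> 'b"
    and A' :: "'m::ab_group_add \<Rightarrow> 'b set"
    and \<phi> :: "'a ^ 'n::finite ^ 'n \<Rightarrow> 'b ^ 'n ^ 'n"
  assumes A: "graded_assoc_algebra smul A" and A': "graded_assoc_algebra smul' A'"
    and iso: "lie_algebra_iso (sl smul A) (sl smul' A') \<phi>"
    and ij: "i \<noteq> j" and ab: "a \<noteq> b" and bij_\<gamma>: "bij \<gamma>"
    and comp: "\<And>l. \<phi> ` sl_comp smul A (root_A i j) (l + t) = sl_comp smul' A' (root_A a b) (\<gamma> l)"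
  obtains g where "\<And>x. \<phi> (e_mat i j x) = e_mat a b (g x)" "bij g"
    "\<And>l. g ` A (l + t) = A' (\<gamma> l)" "Vector_Spaces.linear smul smul' g"
proof -
  interpret A: graded_assoc_algebra smul A by (fact A)
  interpret A': graded_assoc_algebra smul' A' by (fact A')
  define g where "g x = \<phi> (e_mat i j x) $ a $ b" for x
  \<comment> \<open>Off-diagonal matrix units have trace zero, so the properties of \<phi>, known
    only on the carrier, apply to them.\<close>
  have carrier: "e_mat i j x \<in> lie_carrier (sl smul A)" for x
    by (simp add: sl_def trace_e_mat ij commutator_span_def A.span_zero)
  have \<phi>_add: "\<phi> (e_mat i j x + e_mat i j y) = \<phi> (e_mat i j x) + \<phi> (e_mat i j y)" for x y
    using iso carrier by (auto simp: lie_algebra_iso_def)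
  have \<phi>_inj: "\<phi> (e_mat i j x) = \<phi> (e_mat i j y) \<longleftrightarrow> x = y" for x y
    using iso carrier by (auto simp: lie_algebra_iso_def bij_betw_def inj_on_eq_iff)
  have \<phi>_0: "\<phi> 0 = 0"
    using \<phi>_add[of 0 0] by simp
  have image: "\<phi> ` e_mat i j ` A (l + t) = e_mat a b ` A' (\<gamma> l)" for l
    using comp[of l] ij ab by (simp add: sl_comp_root)
  \<comment> \<open>Only images of homogeneous elements are controlled by \<open>comp\<close>;
    additivity extends the equation to all \<open>x\<close>. Degree \<open>l\<close> of the algebra
    is degree \<open>l - t\<close> of the shifted grading.\<close>
  have eq: "\<phi> (e_mat i j x) = e_mat a b (g x)" for x
  proof (induction x rule: A.component_induct)
    case zero
    show ?case by (simp add: g_def \<phi>_0)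
  next
    case (add x y)
    thus ?case by (simp add: e_mat_add \<phi>_add g_def)
  next
    case (component l x)
    hence "\<phi> (e_mat i j x) \<in> e_mat a b ` A' (\<gamma> (l - t))"
      using image[of "l - t"] by auto
    thus ?case by (auto simp: g_def e_mat_nth)
  qed
  have g_add: "g (x + y) = g x + g y" for x y
    by (simp add: g_def e_mat_add \<phi>_add)
  have scale_e: "e_mat i j (smul c x) = lie_scale (sl smul A) c (e_mat i j x)" for c x
    by (simp add: sl_def vec_eq_iff e_mat_nth)
  have "\<phi> (e_mat i j (smul c x)) = lie_scale (sl smul' A') c (\<phi> (e_mat i j x))" for c x
    unfolding scale_e using iso carrier by (simp add: lie_algebra_iso_def)
  hence "g (smul c x) = smul' c (g x)" for c x
    by (simp add: g_def sl_def)
  with g_add have "Vector_Spaces.linear smul smul' g"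
    by unfold_locales auto
  moreover have comp_g: "g ` A (l + t) = A' (\<gamma> l)" for l
  proof -
    have "e_mat a b ` g ` A (l + t) = e_mat a b ` A' (\<gamma> l)"
      using image[of l] by (simp add: image_image eq)
    thus ?thesis
      by (rule inj_image_eq_iff[THEN iffD1, rotated]) (simp add: inj_def)
  qed
  moreover have "bij g"
  proof (rule bijI)
    show "inj g"
      by (rule injI) (metis eq \<phi>_inj)
    \<comment> \<open>Surjectivity of \<gamma> places every homogeneous \<open>y\<close> in the
      image of some component, and sums follow by additivity.\<close>
    have "y \<in> range g" for y
    proof (induction y rule: A'.component_induct)
      case zero
      show ?case by (rule range_eqI[of _ _ 0]) (simp add: g_def \<phi>_0)
    next
      case (add x y)
      thus ?case by (auto simp flip: g_add)
    next
      case (component m y)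
      then obtain l where "m = \<gamma> l"
        using bij_\<gamma> by (metis bij_pointE)
      thus ?case
        using component comp_g[of l] by blast
    qed
    thus "surj g" by blast
  qed
  ultimately show ?thesis
    using that eq by blast
qed

section \<open>Recovering the torus from three root spaces\<close>

lemma lie_algebra_iso_regrade: "lie_algebra_iso (regrade s L) L' \<phi> \<longleftrightarrow> lie_algebra_iso L L' \<phi>"
  by (simp add: lie_algebra_iso_def regrade_def)

lemma lie_comp_regrade_sl:
  "lie_comp (regrade s (sl smul A)) \<beta> l = sl_comp smul A \<beta> (l + s \<beta>)"
  "lie_comp (sl smul A) \<beta> l = sl_comp smul A \<beta> l"
  by (simp_all add: regrade_def sl_def)

lemma isograded_isomorphic_of_isotopic:
  fixes smul :: "'k::field_char_0 \<Rightarrow> 'a::ring_1 \<Rightarrow> 'a"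
    and A :: "'l::ab_group_add \<Rightarrow> 'a set"
    and smul' :: "'k \<Rightarrow> 'b::ring_1 \<Rightarrow> 'b"
    and A' :: "'m::ab_group_add \<Rightarrow> 'b set"
  assumes A: "assoc_torus smul A" and A': "assoc_torus smul' A'"
    and card: "CARD('n::finite) \<ge> 3"
    and isot: "isotopic roots_A (sl smul A :: ('k, 'a ^ 'n ^ 'n, 'k ^ 'n, _) graded_lie) (sl smul' A')"
  shows "isograded_isomorphic smul (*) A smul' (*) A' \<or>
    isograded_isomorphic smul (*) A smul' op_mult A'"
proof -
  interpret A: assoc_torus smul A by (fact A)
  interpret A': assoc_torus smul' A' by (fact A')
  note gA = A.graded_assoc_algebra_axioms and gA' = A'.graded_assoc_algebra_axioms
  let ?Q = "group_closure roots_A :: ('k ^ 'n) set"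
  from isot obtain s \<phi> \<rho> \<gamma> where
    iso: "lie_algebra_iso (sl smul A :: ('k, 'a ^ 'n ^ 'n, 'k ^ 'n, _) graded_lie) (sl smul' A') \<phi>"
    and \<rho>: "group_hom_on ?Q \<rho>" "bij_betw \<rho> ?Q ?Q"
    and hom: "group_hom_on UNIV \<gamma>" and bij_\<gamma>: "bij \<gamma>"
    and comp: "\<And>\<beta> l. \<beta> \<in> ?Q \<Longrightarrow> \<phi> ` sl_comp smul A \<beta> (l + s \<beta>) = sl_comp smul' A' (\<rho> \<beta>) (\<gamma> l)"
    unfolding isotopic_def bi_isomorphic_def lie_algebra_iso_regrade lie_comp_regrade_sl
    by (elim exE conjE) (rule that, assumption+, blast)
  have carrier: "e_mat i j x \<in> lie_carrier (sl smul A)" if "i \<noteq> j" for i j :: 'n and x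
    using that by (simp add: sl_def trace_e_mat commutator_span_def A.span_zero)
  \<comment> \<open>With \<open>i \<noteq> k\<close> the reverse product of the matrix units
    vanishes, so a single bracket records the product \<open>x * y\<close>.\<close>
  have bracket: "\<phi> (e_mat i k (x * y)) =
      \<phi> (e_mat i j x) ** \<phi> (e_mat j k y) - \<phi> (e_mat j k y) ** \<phi> (e_mat i j x)"
    if "i \<noteq> j" "j \<noteq> k" "i \<noteq> k" for i j k :: 'n and x y
  proof -
    have "e_mat i k (x * y) = lie_bracket (sl smul A) (e_mat i j x) (e_mat j k y)"
      using that by (simp add: sl_def e_mat_mult)
    thus ?thesis
      using iso carrier that by (simp add: lie_algebra_iso_def) (simp add: sl_def)
  qed
  have "\<rho> (0 + 0) = \<rho> 0 + \<rho> 0"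
    using \<rho>(1) zero_in_group_closure unfolding group_hom_on_def by blast
  hence \<rho>_0: "\<rho> 0 = 0"
    by simp
  have "0 \<in> lie_carrier (sl smul A)"
    by (simp add: sl_def trace_def commutator_span_def A.span_zero)
  hence "\<phi> (0 + 0) = \<phi> 0 + \<phi> 0"
    using iso unfolding lie_algebra_iso_def by blast
  hence \<phi>_0: "\<phi> 0 = 0"
    by simp
  \<comment> \<open>\<rho> is given only as an automorphism of the root lattice. A nonroot value
    would force the image of a root component to be \<open>{0}\<close>, although every such
    component is nonzero and \<phi> is injective.\<close>
  have \<rho>_root: "\<exists>a b. a \<noteq> b \<and> \<rho> (root_A i j) = root_A a b" if ij: "i \<noteq> j" for i j :: 'n
  proof (rule ccontr)
    assume *: "\<not> ?thesis"
    have "\<rho> (root_A i j) \<noteq> \<rho> 0"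
      using \<rho>(2) root_A_in_group_closure[OF ij] root_A_nonzero[OF ij]
      by (metis bij_betw_def inj_on_eq_iff zero_in_group_closure)
    with * \<rho>_0 have "\<rho> (root_A i j) \<notin> roots_A"
      by (auto simp: roots_A_def)
    hence image: "\<phi> ` sl_comp smul A (root_A i j) (0 + s (root_A i j)) = {0}"
      using comp[OF root_A_in_group_closure[OF ij], of 0] by (simp add: sl_comp_nonroot)
    obtain x where x: "x \<in> A (s (root_A i j))" "x \<noteq> 0"
      using A.component_nonzero[of "s (root_A i j)"] A.zero_component[of "s (root_A i j)"] by blast
    hence "\<phi> (e_mat i j x) = \<phi> (e_mat i j 0)"
      using image ij \<phi>_0 by (auto simp: sl_comp_root)
    hence "x = 0"
      using iso inj_on_eq_iff[OF _ carrier[OF ij] carrier[OF ij], of \<phi>]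
      by (simp add: lie_algebra_iso_def bij_betw_def del: e_mat_zero)
    with x show False by simp
  qed
  have \<rho>_add: "\<rho> (root_A i j) + \<rho> (root_A j k) = \<rho> (root_A i k)"
    if "i \<noteq> j" "j \<noteq> k" for i j k
  proof -
    have "\<rho> (root_A i j + root_A j k) = \<rho> (root_A i j) + \<rho> (root_A j k)"
      using \<rho>(1) that by (simp add: group_hom_on_def root_A_in_group_closure)
    thus ?thesis by (simp add: root_A_def)
  qed
  obtain T :: "'n set" where "card T = 3"
    using card by (meson obtain_subset_with_card_n)
  then obtain i j k :: 'n where ijk: "i \<noteq> j" "j \<noteq> k" "i \<noteq> k"
    by (auto simp: card_3_iff)
  obtain a b c d e f where ends: "a \<noteq> b" "c \<noteq> d" "e \<noteq> f"
    and \<rho>_eq: "\<rho> (root_A i j) = root_A a b" "\<rho> (root_A j k) = root_A c d" "\<rho> (root_A i k) = root_A e f"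
    using \<rho>_root ijk by metis
  note comp' = comp[OF root_A_in_group_closure]
  obtain h where h: "\<And>x. \<phi> (e_mat i j x) = e_mat a b (h x)" "bij h"
      "\<And>l. h ` A (l + s (root_A i j)) = A' (\<gamma> l)" "Vector_Spaces.linear smul smul' h"
    by (rule root_space_map[OF gA gA' iso ijk(1) ends(1) bij_\<gamma> comp'[OF ijk(1), unfolded \<rho>_eq]]) (rule that)
  obtain k' where k': "\<And>x. \<phi> (e_mat j k x) = e_mat c d (k' x)" "bij k'"
      "\<And>l. k' ` A (l + s (root_A j k)) = A' (\<gamma> l)" "Vector_Spaces.linear smul smul' k'"
    by (rule root_space_map[OF gA gA' iso ijk(2) ends(2) bij_\<gamma> comp'[OF ijk(2), unfolded \<rho>_eq]]) (rule that)
  obtain g where g: "\<And>x. \<phi> (e_mat i k x) = e_mat e f (g x)" "bij g"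
      "\<And>l. g ` A (l + s (root_A i k)) = A' (\<gamma> l)" "Vector_Spaces.linear smul smul' g"
    by (rule root_space_map[OF gA gA' iso ijk(3) ends(3) bij_\<gamma> comp'[OF ijk(3), unfolded \<rho>_eq]]) (rule that)
  \<comment> \<open>Choosing \<open>l = - t\<close> reaches degree 0, so \<open>p 1\<close> is a
    nonzero homogeneous element and thus invertible.\<close>
  have unit: "\<exists>w. w * p 1 = 1"
    if "bij p" "\<And>l. p ` A (l + t) = A' (\<gamma> l)" "Vector_Spaces.linear smul smul' p" for p t
  proof -
    interpret p: Vector_Spaces.linear smul smul' p by (fact that(3))
    have "p 1 \<noteq> 0"
      using that(1) p.zero injD[of p 1 0] by (auto simp: bij_def)
    moreover have "p 1 \<in> A' (\<gamma> (- t))"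
      using that(2)[of "- t"] A.one_component by auto
    ultimately show ?thesis
      using A'.component_invertible by blast
  qed
  \<comment> \<open>Additivity of \<gamma> turns the isotope shift into a constant \<tau>, the form
    required for the factorisation result.\<close>
  have comp_g: "g ` A l = A' (\<gamma> l + \<gamma> (- s (root_A i k)))" for l
  proof -
    have "\<gamma> (l + - s (root_A i k)) = \<gamma> l + \<gamma> (- s (root_A i k))"
      using hom unfolding group_hom_on_def by blast
    with g(3)[of "l + - s (root_A i k)"] show ?thesis by simp
  qed
  note fac = isograded_isomorphic_of_factorisation[OF A A' g(4,2) comp_g hom bij_\<gamma>]
  have "root_A a b + root_A c d = (root_A e f :: 'k ^ 'n)"
    using \<rho>_add[OF ijk(1,2)] unfolding \<rho>_eq .
  from root_A_add_eq_root_A[OF ends this] show ?thesis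
  proof (elim disjE conjE)
    assume eqs: "b = c" "e = a" "f = d"
    obtain w where w: "w * h 1 = 1" using unit[OF h(2-4)] by blast
    \<comment> \<open>The reverse product in the bracket vanishes because
      \<open>e \<noteq> f\<close> means \<open>a \<noteq> d\<close>.\<close>
    have "g (x * y) = h x * k' y" for x y
    proof -
      have "e_mat a d (g (x * y)) = e_mat a d (h x * k' y)"
        using bracket[OF ijk, of x y] eqs ends by (simp add: h(1) k'(1) g(1) e_mat_mult)
      thus ?thesis by simp
    qed
    with w fac(1)[where w = w and h = h and k = k'] show ?thesis by blast
  next
    assume eqs: "a = d" "e = c" "f = b"
    obtain w where w: "w * k' 1 = 1" using unit[OF k'(2-4)] by blast
    \<comment> \<open>Now \<open>e \<noteq> f\<close> means \<open>b \<noteq> c\<close>, so only the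
      subtracted product survives. Its sign is absorbed into \<open>h\<close>, leaving
      \<open>k'\<close> and its left inverse \<open>w\<close> untouched.\<close>
    have "g (x * y) = k' y * (- h x)" for x y
    proof -
      have "e_mat c b (g (x * y)) = - e_mat c b (k' y * h x)"
        using bracket[OF ijk, of x y] eqs ends by (simp add: h(1) k'(1) g(1) e_mat_mult)
      thus ?thesis by (simp flip: e_mat_uminus)
    qed
    with w fac(2)[where w = w and h = "\<lambda>x. - h x" and k = k'] show ?thesis by blast
  qed
qed

theorem theorem10p6:
  fixes r :: nat
    and smul :: "'k::field_char_0 \<Rightarrow> 'a::ring_1 \<Rightarrow> 'a"
    and A :: "'l::ab_group_add \<Rightarrow> 'a set"
    and smul' :: "'k \<Rightarrow> 'b::ring_1 \<Rightarrow> 'b"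
    and A' :: "'m::ab_group_add \<Rightarrow> 'b set"
    and \<Delta> :: "('k ^ 'n::finite) set"
    and LA :: "('k, 'a ^ 'n ^ 'n, 'k ^ 'n, 'l) graded_lie"
    and LA' :: "('k, 'b ^ 'n ^ 'n, 'k ^ 'n, 'm) graded_lie"
  assumes "r \<ge> 3" and "CARD('n) = r + 1"
    and "fg_free_abelian_group TYPE('l)" and "fg_free_abelian_group TYPE('m)"
    and "assoc_torus smul A" and "assoc_torus smul' A'"
    and "\<Delta> = roots_A" and "LA = sl smul A" and "LA' = sl smul' A'"
  shows "((isograded_isomorphic smul (*) A smul' (*) A' \<or>
           isograded_isomorphic smul (*) A smul' op_mult A') \<longleftrightarrow> bi_isomorphic \<Delta> LA LA') \<and>
         (bi_isomorphic \<Delta> LA LA' \<longleftrightarrow> isotopic \<Delta> LA LA')"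
proof -
  interpret A: assoc_torus smul A by fact
  interpret A': assoc_torus smul' A' by fact
  note gA = A.graded_assoc_algebra_axioms and gA' = A'.graded_assoc_algebra_axioms
  \<comment> \<open>The flag \<open>False\<close> selects the entrywise map; \<open>True\<close>,
    for the opposite algebra, selects the negated transpose.\<close>
  have "bi_isomorphic \<Delta> LA LA'" if "isograded_isomorphic smul (*) A smul' (*) A'"
    using that bi_isomorphic_sl[OF gA gA', of _ False] assms(7-9)
    by (auto simp: isograded_isomorphic_def)
  moreover have "bi_isomorphic \<Delta> LA LA'" if "isograded_isomorphic smul (*) A smul' op_mult A'"
    using that bi_isomorphic_sl[OF gA gA', of _ True] assms(7-9)
    by (auto simp: isograded_isomorphic_def op_mult_def)
  moreover have "isotopic \<Delta> LA LA'" if "bi_isomorphic \<Delta> LA LA'"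
    using that A.isotopic_of_bi_isomorphic assms(7-9) by blast
  moreover have "isograded_isomorphic smul (*) A smul' (*) A' \<or>
      isograded_isomorphic smul (*) A smul' op_mult A'" if "isotopic \<Delta> LA LA'"
    using isograded_isomorphic_of_isotopic[OF assms(5,6) _ that[unfolded assms(7-9)]] assms(1,2) by simp
  ultimately show ?thesis by blast
qed

end
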